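(* Let $K\ge1$ be an integer with $K\equiv 0$ or $2\pmod 4$, and let $p_1,\dots,p_r$ be the distinct primes dividing $K^2+4$. For every integer $m>1$ there exists $N$ such that for all $n\ge N$, $\pi_K^n(m)=p_1^{j_1}\cdots p_r^{j_r}$ for some integers $j_1,\dots,j_r\ge0$.
   Context: The $K$-Fibonacci sequence is $F_{K,0}=0$, $F_{K,1}=1$, $F_{K,n}=K F_{K,n-1}+F_{K,n-2}$; for an integer $m>1$, $\pi_K(m)$ is the length of its shortest period modulo $m$; iterates are $\pi_K^1=\pi_K$ and $\pi_K^{n+1}(m)=\pi_K(\pi_K^n(m))$. *)

theory Defs
  imports "HOL-Number_Theory.Number_Theory"
begin

fun kfib :: "nat \<Rightarrow> nat \<Rightarrow> nat" where
  "kfib K 0 = 0"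
| "kfib K (Suc 0) = 1"
| "kfib K (Suc (Suc n)) = K * kfib K (Suc n) + kfib K n"

text \<open>The recurrence is invertible modulo \<open>m\<close>, so the sequence is purely periodic and no
  preperiod needs to be allowed for.\<close>

definition pisano :: "nat \<Rightarrow> nat \<Rightarrow> nat" where
  "pisano K m = (LEAST t. t > 0 \<and> (\<forall>n. [kfib K (n + t) = kfib K n] (mod m)))"

end

theory Submission
  imports Defs "HOL-Computational_Algebra.Polynomial"
begin

text \<open>
  In both cases \<open>K = 2a\<close> is even. Put \<open>d = a\<^sup>2 + 1\<close>, so that \<open>K\<^sup>2 + 4 = 4d\<close>, and let
  \<open>\<alpha> = a + \<surd>d\<close>, a unit of \<open>\<int>[\<surd>d]\<close>. The \<open>K\<close>-Fibonacci number of index \<open>n\<close> is the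
  \<open>\<surd>d\<close>-coordinate of \<open>\<alpha>\<^sup>n\<close>, hence every \<open>t > 0\<close> with \<open>\<alpha>\<^sup>t \<equiv> 1 (mod m)\<close> is a multiple of the
  period modulo \<open>m\<close>. For a prime \<open>p\<close> dividing \<open>K\<^sup>2 + 4\<close> one may take \<open>t = 4p\<close> modulo \<open>p\<close>; for
  any other prime, applying Frobenius twice fixes \<open>\<alpha>\<close>, so \<open>t = p\<^sup>2 - 1\<close> works; passing from
  \<open>p\<close> to \<open>p\<^sup>e\<close> costs a factor \<open>p\<^bsup>e-1\<^esup>\<close>. The latter primes are odd,
  because \<open>K\<^sup>2 + 4\<close> is even, so all prime factors of \<open>p\<^sup>2 - 1\<close> are smaller than \<open>p\<close>.
  Consequently the largest prime factor of \<open>m\<close> not dividing \<open>K\<^sup>2 + 4\<close> loses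
  at least one from its exponent in each step, no larger such prime ever appears, and all of
  them eventually die out.
\<close>

section \<open>Periods as multiples of the least period\<close>

text \<open>The remainder of \<open>t\<close> modulo the least period is a smaller shift with the
  same property, so it must be zero. Positivity is recorded because \<open>LEAST\<close> is
  meaningful only once some period exists.\<close>

lemma pisano_dvd:
  assumes t: "t > 0" "\<And>n. [kfib K (n + t) = kfib K n] (mod m)"
  shows "pisano K m > 0" "pisano K m dvd t"
proof -
  let ?P = "\<lambda>t. t > 0 \<and> (\<forall>n. [kfib K (n + t) = kfib K n] (mod m))"
  define s where "s = pisano K m"
  have "?P t" using t by blast
  then have s: "?P s" unfolding s_def pisano_def by (rule LeastI)
  then show "pisano K m > 0" by (simp add: s_def)
  have mult: "[kfib K (n + s * k) = kfib K n] (mod m)" for n k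
  proof (induction k)
    case (Suc k)
    have "[kfib K (n + s * k + s) = kfib K (n + s * k)] (mod m)" using s by blast
    with Suc show ?case by (auto simp: algebra_simps intro: cong_trans)
  qed simp
  have "[kfib K (n + t mod s) = kfib K n] (mod m)" for n
  proof -
    have "[kfib K (n + t mod s + s * (t div s)) = kfib K (n + t mod s)] (mod m)" by (rule mult)
    moreover have "n + t mod s + s * (t div s) = n + t" by simp
    ultimately show ?thesis using t(2)[of n] by (metis cong_sym cong_trans)
  qed
  moreover have "t mod s < s" using s by simp
  then have "\<not> ?P (t mod s)" unfolding s_def pisano_def by (rule not_less_Least)
  ultimately have "t mod s = 0" by (metis gr0I)
  then show "pisano K m dvd t" by (auto simp: s_def)
qed

section \<open>Congruences in the ring \<open>Z[sqrt d]\<close>\<close>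

text \<open>Realised inside the reals so that the ring laws are inherited; uniqueness of coordinates
  then comes from the irrationality of \<open>sqrt d\<close>.\<close>

definition Zsqrt :: "nat \<Rightarrow> real set" where
  "Zsqrt d = {of_int x + of_int y * sqrt d | x y. True}"

lemma of_int_Zsqrt [simp]: "of_int x \<in> Zsqrt d"
  by (force simp: Zsqrt_def intro: exI[of _ x] exI[of _ 0])

lemma of_nat_Zsqrt [simp]: "of_nat x \<in> Zsqrt d"
  using of_int_Zsqrt[of "int x"] by simp

lemma one_Zsqrt [simp]: "1 \<in> Zsqrt d"
  using of_int_Zsqrt[of 1] by simp

lemma zero_Zsqrt [simp]: "0 \<in> Zsqrt d"
  using of_int_Zsqrt[of 0] by simp

lemma sqrt_Zsqrt [simp]: "sqrt (of_nat d) \<in> Zsqrt d"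
  by (force simp: Zsqrt_def intro: exI[of _ 0] exI[of _ 1])

lemma add_Zsqrt [intro, simp]: "u \<in> Zsqrt d \<Longrightarrow> v \<in> Zsqrt d \<Longrightarrow> u + v \<in> Zsqrt d"
proof -
  assume "u \<in> Zsqrt d" "v \<in> Zsqrt d"
  then obtain x y x' y' :: int where "u = x + y * sqrt d" "v = x' + y' * sqrt d"
    by (auto simp: Zsqrt_def)
  then have "u + v = of_int (x + x') + of_int (y + y') * sqrt d"
    by (simp add: algebra_simps)
  then show ?thesis unfolding Zsqrt_def by blast
qed

lemma mult_Zsqrt [intro, simp]: "u \<in> Zsqrt d \<Longrightarrow> v \<in> Zsqrt d \<Longrightarrow> u * v \<in> Zsqrt d"
proof -
  assume "u \<in> Zsqrt d" "v \<in> Zsqrt d"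
  then obtain x y x' y' :: int where "u = x + y * sqrt d" "v = x' + y' * sqrt d"
    by (auto simp: Zsqrt_def)
  then have "u * v = of_int x * of_int x' + (of_int y * of_int y') * (sqrt d * sqrt d)
      + of_int (x * y' + x' * y) * sqrt d"
    by (simp add: algebra_simps del: real_sqrt_mult_self)
  also have "\<dots> = of_int (x * x' + y * y' * int d) + of_int (x * y' + x' * y) * sqrt d"
    by simp
  finally show ?thesis unfolding Zsqrt_def by blast
qed

lemma uminus_Zsqrt [intro, simp]: "u \<in> Zsqrt d \<Longrightarrow> - u \<in> Zsqrt d"
  using mult_Zsqrt[of "of_int (-1)" d u] of_int_Zsqrt[of "-1" d] by simp

lemma diff_Zsqrt [intro, simp]: "u \<in> Zsqrt d \<Longrightarrow> v \<in> Zsqrt d \<Longrightarrow> u - v \<in> Zsqrt d"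
  using add_Zsqrt[of u d "- v"] by simp

lemma power_Zsqrt [intro, simp]: "u \<in> Zsqrt d \<Longrightarrow> u ^ n \<in> Zsqrt d"
  by (induction n) auto

lemma sum_Zsqrt: "(\<And>i. i \<in> A \<Longrightarrow> f i \<in> Zsqrt d) \<Longrightarrow> sum f A \<in> Zsqrt d"
  by (induction A rule: infinite_finite_induct) auto

text \<open>On \<open>Z[sqrt d]\<close> this is congruence modulo the ideal generated by
  \<open>m\<close>. Membership of \<open>u\<close> and \<open>v\<close> is not built in, so the
  product rules ask for it.\<close>

definition Zsqrt_cong :: "nat \<Rightarrow> nat \<Rightarrow> real \<Rightarrow> real \<Rightarrow> bool" where
  "Zsqrt_cong d m u v \<longleftrightarrow> (\<exists>w\<in>Zsqrt d. u - v = of_nat m * w)"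

lemma Zsqrt_cong_refl [simp]: "Zsqrt_cong d m u u"
  by (auto simp: Zsqrt_cong_def intro!: bexI[of _ 0])

lemma Zsqrt_cong_add:
  assumes "Zsqrt_cong d m u v" "Zsqrt_cong d m u' v'"
  shows "Zsqrt_cong d m (u + u') (v + v')"
proof -
  obtain w w' :: real where "w \<in> Zsqrt d" "w' \<in> Zsqrt d" "u - v = m * w" "u' - v' = m * w'"
    using assms by (auto simp: Zsqrt_cong_def)
  then have "u + u' - (v + v') = m * (w + w')" "w + w' \<in> Zsqrt d" by (auto simp: algebra_simps)
  then show ?thesis unfolding Zsqrt_cong_def by blast
qed

lemma Zsqrt_cong_trans [trans]:
  assumes "Zsqrt_cong d m u v" "Zsqrt_cong d m v w"
  shows "Zsqrt_cong d m u w"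
  using Zsqrt_cong_add[OF assms] by (simp add: Zsqrt_cong_def)

lemma Zsqrt_cong_mult_left:
  assumes "w \<in> Zsqrt d" "Zsqrt_cong d m u v"
  shows "Zsqrt_cong d m (w * u) (w * v)"
proof -
  obtain z :: real where "z \<in> Zsqrt d" "u - v = m * z" using assms by (auto simp: Zsqrt_cong_def)
  then have "w * u - w * v = m * (w * z)" "w * z \<in> Zsqrt d"
    using assms(1) by (auto simp flip: right_diff_distrib)
  then show ?thesis unfolding Zsqrt_cong_def by blast
qed

lemma Zsqrt_cong_mult:
  assumes "u \<in> Zsqrt d" "v' \<in> Zsqrt d" "Zsqrt_cong d m u v" "Zsqrt_cong d m u' v'"
  shows "Zsqrt_cong d m (u * u') (v * v')"
  using Zsqrt_cong_trans[OF Zsqrt_cong_mult_left[OF assms(1,4)]]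
    Zsqrt_cong_mult_left[OF assms(2,3)] by (simp add: mult.commute)

lemma Zsqrt_cong_power:
  assumes "u \<in> Zsqrt d" "v \<in> Zsqrt d" "Zsqrt_cong d m u v"
  shows "Zsqrt_cong d m (u ^ n) (v ^ n)"
  using assms by (induction n) (auto intro!: Zsqrt_cong_mult)

lemma Zsqrt_cong_power_one:
  assumes "u \<in> Zsqrt d" "Zsqrt_cong d m (u ^ t) 1" "t dvd n"
  shows "Zsqrt_cong d m (u ^ n) 1"
  using assms Zsqrt_cong_power[of "u ^ t" d 1 m] by (auto elim!: dvdE simp: power_mult)

lemma cong_imp_Zsqrt_cong:
  assumes "[x = y] (mod int m)"
  shows "Zsqrt_cong d m (of_int x) (of_int y)"
proof -
  obtain k where "x - y = int m * k" using assms by (auto simp: cong_iff_dvd_diff)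
  then have "real_of_int x - of_int y = of_nat m * of_int k"
    by (metis of_int_diff of_int_mult of_int_of_nat_eq)
  then show ?thesis unfolding Zsqrt_cong_def by (blast intro: of_int_Zsqrt)
qed

section \<open>Additivity of Frobenius and lifting to prime powers\<close>

text \<open>All inner binomial coefficients of exponent \<open>p\<close> are multiples of
  \<open>p\<close>.\<close>

lemma Zsqrt_cong_power_prime:
  assumes p: "prime p" and u: "u \<in> Zsqrt d" and v: "v \<in> Zsqrt d"
  shows "Zsqrt_cong d p ((u + v) ^ p) (u ^ p + v ^ p)"
proof -
  let ?f = "\<lambda>k. of_nat (p choose k) * u ^ k * v ^ (p - k)"
  have p1: "p > 1" using p prime_gt_1_nat by blast
  have "{..p} = insert 0 (insert p {0<..<p})" by auto
  then have "(u + v) ^ p = u ^ p + v ^ p + (\<Sum>k\<in>{0<..<p}. ?f k)"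
    using p1 by (simp add: binomial_ring)
  also have "(\<Sum>k\<in>{0<..<p}. ?f k) =
      of_nat p * (\<Sum>k\<in>{0<..<p}. of_nat ((p choose k) div p) * u ^ k * v ^ (p - k))"
    unfolding sum_distrib_left
  proof (rule sum.cong)
    fix k assume "k \<in> {0<..<p}"
    then have "p dvd (p choose k)" using p by (intro dvd_choose_prime) auto
    then have "real (p choose k) = of_nat p * of_nat ((p choose k) div p)"
      by (metis dvd_mult_div_cancel of_nat_mult)
    then show "?f k = of_nat p * (of_nat ((p choose k) div p) * u ^ k * v ^ (p - k))" by simp
  qed simp
  finally have "(u + v) ^ p - (u ^ p + v ^ p) =
      of_nat p * (\<Sum>k\<in>{0<..<p}. of_nat ((p choose k) div p) * u ^ k * v ^ (p - k))" by simp
  moreover have "(\<Sum>k\<in>{0<..<p}. of_nat ((p choose k) div p) * u ^ k * v ^ (p - k)) \<in> Zsqrt d"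
    using u v by (intro sum_Zsqrt) auto
  ultimately show ?thesis unfolding Zsqrt_cong_def by blast
qed

text \<open>In \<open>u ^ p - 1 = (u - 1) * (\<Sum>i<p. u ^ i)\<close> the first factor is divisible
  by \<open>p ^ Suc e\<close>, and the second contributes one more \<open>p\<close>, being a sum of
  \<open>p\<close> terms congruent to 1.\<close>

lemma Zsqrt_cong_one_lift:
  assumes p: "prime p" and u: "Zsqrt_cong d (p ^ Suc e) u 1"
  shows "Zsqrt_cong d (p ^ Suc (Suc e)) (u ^ p) 1"
proof -
  obtain w where w: "w \<in> Zsqrt d" "u = 1 + of_nat (p ^ Suc e) * w"
    using u by (auto simp: Zsqrt_cong_def algebra_simps)
  have u_in: "u \<in> Zsqrt d" unfolding w(2) using w(1) by (intro add_Zsqrt mult_Zsqrt) auto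
  have "Zsqrt_cong d p u 1"
    using w by (auto simp: Zsqrt_cong_def simp del: of_nat_power
        intro!: bexI[of _ "of_nat (p ^ e) * w"])
  then have "Zsqrt_cong d p (u ^ i) 1" for i
    using Zsqrt_cong_power[of u d 1 p i] u_in by simp
  then have "Zsqrt_cong d p (\<Sum>i<n. u ^ i) (of_nat n)" for n
    by (induction n) (auto simp: add.commute[of "1::real"] intro!: Zsqrt_cong_add)
  \<comment> \<open>At \<open>n = p\<close> the sum differs from \<open>p\<close> by some
    \<open>p * z\<close>, which gives the factor \<open>1 + z\<close>.\<close>
  then obtain z where z: "z \<in> Zsqrt d" "(\<Sum>i<p. u ^ i) = of_nat p * (1 + z)"
    by (auto simp: Zsqrt_cong_def algebra_simps)
  have "u ^ p - 1 = (u - 1) * (\<Sum>i<p. u ^ i)"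
    by (rule power_diff_1_eq)
  also have "\<dots> = of_nat (p ^ Suc (Suc e)) * (w * (1 + z))"
    unfolding z(2) by (simp add: w(2) algebra_simps)
  finally show ?thesis
    unfolding Zsqrt_cong_def using w(1) z(1) by (intro bexI[of _ "w * (1 + z)"]) auto
qed

lemma Zsqrt_cong_prime_power:
  assumes p: "prime p" and u: "Zsqrt_cong d p (u ^ t) 1"
  shows "Zsqrt_cong d (p ^ Suc e) (u ^ (t * p ^ e)) 1"
proof (induction e)
  case (Suc e)
  from Zsqrt_cong_one_lift[OF p this] show ?case
    by (simp add: power_mult[symmetric] mult_ac)
qed (use u in simp)

section \<open>Coordinates and reduction to prime powers\<close>

text \<open>The root is an algebraic integer, so if rational it would be an integer, yet it lies
  strictly between \<open>a\<close> and \<open>a + 1\<close>.\<close>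

lemma sqrt_Suc_square_irrational:
  assumes "a \<ge> 1"
  shows "sqrt (real (a\<^sup>2 + 1)) \<notin> \<rat>"
proof
  assume "sqrt (real (a\<^sup>2 + 1)) \<in> \<rat>"
  moreover have "algebraic_int (sqrt (real (a\<^sup>2 + 1)))"
    by (intro algebraic_int_sqrt) (rule int_imp_algebraic_int, rule Ints_of_nat)
  ultimately have "sqrt (real (a\<^sup>2 + 1)) \<in> \<int>"
    by (rule rational_algebraic_int_is_int[rotated])
  then obtain x where x: "sqrt (real (a\<^sup>2 + 1)) = of_int x" by (auto elim: Ints_cases)
  have "real a < sqrt (real (a\<^sup>2 + 1))" by (rule real_less_rsqrt) simp
  moreover have "sqrt (real (a\<^sup>2 + 1)) < real a + 1"
    using assms by (intro real_less_lsqrt) (auto simp: power2_eq_square algebra_simps)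
  ultimately have "int a < x" "x < int a + 1" unfolding x by linarith+
  then show False by linarith
qed

text \<open>Irrationality makes coordinates unique: a nonzero coefficient of \<open>sqrt d\<close>
  would express it as a quotient of integers.\<close>

lemma Zsqrt_cong_iff_dvd:
  assumes irr: "sqrt (real d) \<notin> \<rat>"
  shows "Zsqrt_cong d m (of_int x + of_int y * sqrt d) (of_int x' + of_int y' * sqrt d)
     \<longleftrightarrow> int m dvd x - x' \<and> int m dvd y - y'" (is "?L \<longleftrightarrow> ?R")
proof
  assume ?L
  then obtain k l :: int where
    "of_int x + of_int y * sqrt d - (of_int x' + of_int y' * sqrt d) = m * (k + l * sqrt d)"
    by (auto simp: Zsqrt_cong_def Zsqrt_def)
  then have eq: "of_int (y - y' - int m * l) * sqrt d = of_int (int m * k - (x - x'))"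
    by (simp add: algebra_simps)
  have "y - y' - int m * l = 0"
  proof (rule ccontr)
    assume "y - y' - int m * l \<noteq> 0"
    then have "sqrt d = of_int (int m * k - (x - x')) / of_int (y - y' - int m * l)"
      using eq by (metis nonzero_mult_div_cancel_left of_int_eq_0_iff)
    also have "\<dots> \<in> \<rat>" by (intro Rats_divide Rats_of_int)
    finally show False using irr by contradiction
  qed
  moreover from this have "int m * k - (x - x') = 0"
    using eq by (metis mult_zero_left of_int_0 of_int_eq_0_iff)
  ultimately have "y - y' = int m * l" "x - x' = int m * k" by auto
  then show ?R by simp
next
  assume ?R
  then obtain k l where kl: "x = x' + int m * k" "y = y' + int m * l"
    by (metis add.commute diff_add_cancel dvdE)
  have "of_int x + of_int y * sqrt d - (of_int x' + of_int y' * sqrt d)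
      = m * (of_int k + of_int l * sqrt d)"
    by (simp add: kl algebra_simps)
  then show ?L unfolding Zsqrt_cong_def Zsqrt_def by blast
qed


lemma dvd_if_prime_power_dvd:
  fixes z :: int
  assumes "m > 0" "\<And>p. p \<in> prime_factors m \<Longrightarrow> int (p ^ multiplicity p m) dvd z"
  shows "int m dvd z"
proof (cases "z = 0")
  case False
  have "m dvd nat \<bar>z\<bar>"
  proof (rule multiplicity_le_imp_dvd)
    fix p :: nat assume p: "prime p"
    show "multiplicity p m \<le> multiplicity p (nat \<bar>z\<bar>)"
    proof (cases "p dvd m")
      case True
      then have "int (p ^ multiplicity p m) dvd z"
        using p assms by (auto simp: prime_factors_dvd)
      then have "p ^ multiplicity p m dvd nat \<bar>z\<bar>"
        by (simp flip: int_dvd_int_iff)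
      then show ?thesis using p False
        by (intro multiplicity_geI) (auto simp: prime_gt_0_nat prime_nat_iff)
    qed (simp add: not_dvd_imp_multiplicity_0)
  qed (use assms in simp)
  then show ?thesis by (simp flip: int_dvd_int_iff)
qed simp

text \<open>Passing to coordinates reduces this to divisibility of integers, which is tested one
  prime power at a time.\<close>

lemma Zsqrt_cong_if_prime_powers:
  assumes irr: "sqrt (real d) \<notin> \<rat>" and "u \<in> Zsqrt d" "v \<in> Zsqrt d" "m > 0"
    and "\<And>p. p \<in> prime_factors m \<Longrightarrow> Zsqrt_cong d (p ^ multiplicity p m) u v"
  shows "Zsqrt_cong d m u v"
proof -
  obtain x y x' y' :: int where "u = x + y * sqrt d" "v = x' + y' * sqrt d"
    using assms by (auto simp: Zsqrt_def)
  then show ?thesis using assms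
    by (simp add: Zsqrt_cong_iff_dvd[OF irr] dvd_if_prime_power_dvd del: of_nat_power)
qed

section \<open>The unit \<alpha> and the \<open>K\<close>-Fibonacci numbers\<close>

text \<open>The larger root of \<open>x ^ 2 = K * x + 1\<close> for \<open>K = 2 * a\<close>, the
  characteristic equation of the recurrence.\<close>

definition kunit :: "nat \<Rightarrow> real" where
  "kunit a = real a + sqrt (real (a\<^sup>2 + 1))"

lemma kunit_Zsqrt [simp]: "kunit a \<in> Zsqrt (a\<^sup>2 + 1)"
  unfolding kunit_def by (intro add_Zsqrt of_nat_Zsqrt sqrt_Zsqrt)

lemma kunit_power:
  "kunit a ^ n = of_int (int (kfib (2 * a) (Suc n)) - int a * int (kfib (2 * a) n))
     + of_int (int (kfib (2 * a) n)) * sqrt (real (a\<^sup>2 + 1))"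
proof (induction n)
  case (Suc n)
  define s where "s = sqrt (real (a\<^sup>2 + 1))"
  have s2: "s * s = real a * real a + 1"
    by (simp add: s_def power2_eq_square)
  define f g where "f = real (kfib (2 * a) n)" and "g = real (kfib (2 * a) (Suc n))"
  have "kunit a ^ Suc n = (real a + s) * (g - real a * f + f * s)"
    using Suc by (simp add: kunit_def s_def f_def g_def)
  also have "\<dots> = real a * g - real a * real a * f + g * s + f * (s * s)"
    by (simp add: algebra_simps)
  \<comment> \<open>The recurrence appears here: \<open>2 * a * g + f\<close> is the next term, so
    the rational coordinate has the required shape again.\<close>
  also have "\<dots> = (2 * real a * g + f - real a * g) + g * s"
    unfolding s2 by (simp add: algebra_simps)
  finally show ?case by (simp add: s_def f_def g_def)
qed simp

text \<open>Multiply the congruence by \<alpha> to the power \<open>n\<close> and compare the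
  coefficients of the square root.\<close>

lemma kfib_cong_if_kunit_power:
  assumes "a \<ge> 1" and t: "Zsqrt_cong (a\<^sup>2 + 1) m (kunit a ^ t) 1"
  shows "[kfib (2 * a) (n + t) = kfib (2 * a) n] (mod m)"
proof -
  have "Zsqrt_cong (a\<^sup>2 + 1) m (kunit a ^ n * kunit a ^ t) (kunit a ^ n * 1)"
    using t by (intro Zsqrt_cong_mult_left power_Zsqrt kunit_Zsqrt)
  then have "Zsqrt_cong (a\<^sup>2 + 1) m (kunit a ^ (n + t)) (kunit a ^ n)"
    by (simp add: power_add)
  then have "int m dvd int (kfib (2 * a) (n + t)) - int (kfib (2 * a) n)"
    unfolding kunit_power using Zsqrt_cong_iff_dvd[OF sqrt_Suc_square_irrational[OF assms(1)]]
    by blast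
  then show ?thesis by (simp add: cong_iff_dvd_diff flip: cong_int_iff)
qed

section \<open>Exponents for a single prime\<close>

lemma fermat_little_power:
  fixes x :: nat
  assumes "prime p" shows "[x ^ p = x] (mod p)"
proof (cases "p dvd x")
  case True
  then have "p dvd x ^ p" using prime_gt_0_nat[OF assms] by (meson dvd_power dvd_trans)
  with True show ?thesis by (metis cong_0_iff cong_sym cong_trans)
next
  case False
  then have "[x * x ^ (p - 1) = x * 1] (mod p)"
    using assms by (intro cong_scalar_left fermat_theorem)
  then show ?thesis using assms by (simp add: prime_gt_0_nat flip: power_Suc)
qed

lemma nat_cong_imp_Zsqrt_cong:
  assumes "[x = y] (mod m)"
  shows "Zsqrt_cong d m (of_nat x) (of_nat y)"
  using cong_imp_Zsqrt_cong[of "int x" "int y" m d] assms by (simp add: cong_int_iff)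

lemma sqrt_power_odd:
  assumes "odd n" shows "sqrt (real d) ^ n = real (d ^ (n div 2)) * sqrt (real d)"
proof -
  have "n = 2 * (n div 2) + 1" using assms by presburger
  then have "sqrt (real d) ^ n = (sqrt (real d) ^ 2) ^ (n div 2) * sqrt (real d)"
    by (metis power_add power_mult power_one_right)
  then show ?thesis by simp
qed

text \<open>Frobenius fixes integers modulo \<open>p\<close> and multiplies \<open>sqrt d\<close> by
  \<open>d ^ ((p - 1) / 2)\<close>. Absorbing that power into the coefficient lets the lemma be
  applied to its own result.\<close>

lemma Zsqrt_frobenius:
  assumes p: "prime p" "odd p"
  shows "Zsqrt_cong d p ((real x + real y * sqrt d) ^ p)
           (real x + real (d ^ (p div 2) * y) * sqrt d)"
proof -
  have "Zsqrt_cong d p ((real x + real y * sqrt d) ^ p) (real x ^ p + (real y * sqrt d) ^ p)"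
    by (intro Zsqrt_cong_power_prime p) auto
  also have "real x ^ p + (real y * sqrt d) ^ p
      = real (x ^ p) + (real (d ^ (p div 2)) * sqrt d) * real (y ^ p)"
    by (simp add: power_mult_distrib sqrt_power_odd[OF p(2)])
  also have "Zsqrt_cong d p \<dots> (real x + (real (d ^ (p div 2)) * sqrt d) * real y)"
    using p by (intro Zsqrt_cong_add Zsqrt_cong_mult_left nat_cong_imp_Zsqrt_cong
        fermat_little_power mult_Zsqrt of_nat_Zsqrt sqrt_Zsqrt)
  finally show ?thesis by (simp add: mult_ac)
qed

text \<open>For odd \<open>p\<close> the prime divides \<open>d\<close>, so Frobenius kills the
  square root and \<alpha> to the power \<open>p\<close> is congruent to \<open>a\<close>; then
  \<open>a ^ 4\<close> is congruent to 1 because \<open>a ^ 2\<close> is congruent to -1. For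
  \<open>p = 2\<close> already the square of \<alpha> is congruent to 1, and 2 divides
  \<open>4 * p\<close>.\<close>

lemma kunit_power_ramified:
  assumes p: "prime p" and dvd: "p dvd (2 * a)\<^sup>2 + 4"
  shows "Zsqrt_cong (a\<^sup>2 + 1) p (kunit a ^ (4 * p)) 1"
proof (cases "p = 2")
  case True
  let ?s = "sqrt (real (a\<^sup>2 + 1))"
  have "?s * ?s = real (a\<^sup>2 + 1)" by simp
  then have "kunit a ^ 2 - 1 = real 2 * (real (a\<^sup>2) + real a * ?s)"
    unfolding kunit_def power2_eq_square by (simp add: algebra_simps del: real_sqrt_mult_self)
  moreover have "real (a\<^sup>2) + real a * ?s \<in> Zsqrt (a\<^sup>2 + 1)"
    by (intro add_Zsqrt mult_Zsqrt of_nat_Zsqrt sqrt_Zsqrt)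
  ultimately have "Zsqrt_cong (a\<^sup>2 + 1) 2 (kunit a ^ 2) 1"
    unfolding Zsqrt_cong_def by blast
  then show ?thesis unfolding True by (rule Zsqrt_cong_power_one[OF kunit_Zsqrt]) simp
next
  case False
  then have odd: "odd p" using p prime_odd_nat prime_ge_2_nat[of p] by force
  have "p dvd 2 ^ 2 * (a\<^sup>2 + 1)" using dvd by (simp add: power2_eq_square algebra_simps)
  then have pd: "p dvd a\<^sup>2 + 1"
    using p False by (metis prime_dvd_mult_iff prime_dvd_power primes_dvd_imp_eq two_is_prime_nat)
  have "p div 2 > 0" using odd p prime_gt_1_nat[of p] by auto
  then have pd': "[(a\<^sup>2 + 1) ^ (p div 2) = 0] (mod p)"
    using pd by (simp add: cong_0_iff dvd_power dvd_trans)
  let ?s = "sqrt (real (a\<^sup>2 + 1))"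
  let ?C = "Zsqrt_cong (a\<^sup>2 + 1) p"
  have "?C (kunit a ^ p) (real a + ?s * real ((a\<^sup>2 + 1) ^ (p div 2)))"
    using Zsqrt_frobenius[OF p odd, of "a\<^sup>2 + 1" a 1] by (simp add: kunit_def mult.commute)
  also have "?C \<dots> (real a + ?s * real 0)"
    by (intro Zsqrt_cong_add Zsqrt_cong_refl Zsqrt_cong_mult_left sqrt_Zsqrt
        nat_cong_imp_Zsqrt_cong pd')
  finally have "?C ((kunit a ^ p) ^ 4) (real a ^ 4)"
    by (intro Zsqrt_cong_power power_Zsqrt kunit_Zsqrt of_nat_Zsqrt) simp
  moreover have "?C (real a ^ 4) 1"
  proof -
    obtain k where k: "a\<^sup>2 + 1 = p * k" using pd by blast
    have "real a ^ 4 - 1 = real (a\<^sup>2 + 1) * (real a ^ 2 - 1)"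
      by (simp add: algebra_simps flip: power_add)
    also have "\<dots> = real p * (real k * (real a ^ 2 - 1))"
      unfolding k by simp
    finally have "real a ^ 4 - 1 = real p * (real k * (real a ^ 2 - 1))" .
    then show ?thesis unfolding Zsqrt_cong_def
      by (rule rev_bexI[rotated]) (intro mult_Zsqrt diff_Zsqrt power_Zsqrt of_nat_Zsqrt one_Zsqrt)
  qed
  ultimately show ?thesis by (metis Zsqrt_cong_trans power_mult mult.commute)
qed

text \<open>Two applications of Frobenius multiply the square root by \<open>d ^ (p - 1)\<close>,
  which is 1 modulo \<open>p\<close> by Fermat. This avoids distinguishing whether \<open>d\<close>
  is a square modulo \<open>p\<close>.\<close>

lemma kunit_power_unramified:
  assumes p: "prime p" and ndvd: "\<not> p dvd (2 * a)\<^sup>2 + 4"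
  shows "Zsqrt_cong (a\<^sup>2 + 1) p (kunit a ^ (p\<^sup>2 - 1)) 1"
proof -
  let ?s = "sqrt (real (a\<^sup>2 + 1))"
  let ?C = "Zsqrt_cong (a\<^sup>2 + 1) p"
  have "p \<noteq> 2" using ndvd by (auto simp: power2_eq_square)
  then have odd: "odd p" using p prime_odd_nat prime_ge_2_nat[of p] by force
  have "(2 * a)\<^sup>2 + 4 = 4 * (a\<^sup>2 + 1)" by (simp add: power2_eq_square)
  then have nd: "\<not> p dvd a\<^sup>2 + 1" using ndvd by (metis dvd_mult)
  let ?e = "(a\<^sup>2 + 1) ^ (p div 2)"
  have "?C (kunit a ^ p) (real a + real ?e * ?s)"
    using Zsqrt_frobenius[OF p odd, of "a\<^sup>2 + 1" a 1] by (simp add: kunit_def)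
  then have "?C ((kunit a ^ p) ^ p) ((real a + real ?e * ?s) ^ p)"
    by (intro Zsqrt_cong_power power_Zsqrt kunit_Zsqrt add_Zsqrt mult_Zsqrt of_nat_Zsqrt sqrt_Zsqrt)
  also have "?C \<dots> (real a + real (?e * ?e) * ?s)"
    by (rule Zsqrt_frobenius[OF p odd])
  also have "?e * ?e = (a\<^sup>2 + 1) ^ (p - 1)"
    by (simp only: mult_2[symmetric] odd_two_times_div_two_nat[OF odd] flip: power_add)
  also have "real a + real ((a\<^sup>2 + 1) ^ (p - 1)) * ?s = real a + ?s * real ((a\<^sup>2 + 1) ^ (p - 1))"
    by simp
  also have "?C \<dots> (real a + ?s * real 1)"
    by (intro Zsqrt_cong_add Zsqrt_cong_refl Zsqrt_cong_mult_left sqrt_Zsqrt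
        nat_cong_imp_Zsqrt_cong fermat_theorem p nd)
  finally have "?C (kunit a ^ p\<^sup>2) (kunit a)"
    by (simp add: kunit_def power2_eq_square power_mult)
  \<comment> \<open>The factor \<open>?s - real a\<close> is the inverse of \<alpha>; multiplying by
    it cancels one \<alpha>.\<close>
  then have "?C ((?s - real a) * kunit a ^ p\<^sup>2) ((?s - real a) * kunit a)"
    by (intro Zsqrt_cong_mult_left diff_Zsqrt of_nat_Zsqrt sqrt_Zsqrt)
  moreover have unit: "(?s - real a) * kunit a = 1"
  proof -
    have "(?s - real a) * kunit a = ?s * ?s - real a * real a"
      unfolding kunit_def by (simp add: algebra_simps del: real_sqrt_mult_self)
    then show ?thesis by (simp add: power2_eq_square)
  qed
  moreover have "kunit a ^ p\<^sup>2 = kunit a * kunit a ^ (p\<^sup>2 - 1)"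
    using prime_gt_0_nat[OF p] by (simp flip: power_Suc)
  ultimately show ?thesis by (simp add: mult.assoc[symmetric])
qed

section \<open>A multiple of the period and its prime factors\<close>

definition prime_period :: "nat \<Rightarrow> nat \<Rightarrow> nat" where
  "prime_period K p = (if p dvd K\<^sup>2 + 4 then 4 * p else p\<^sup>2 - 1)"

text \<open>A product rather than a least common multiple, so that multiplicities simply add
  up.\<close>

definition period_bound :: "nat \<Rightarrow> nat \<Rightarrow> nat" where
  "period_bound K m =
     (\<Prod>p\<in>prime_factors m. prime_period K p * p ^ (multiplicity p m - 1))"

lemma prime_period_pos: "prime p \<Longrightarrow> prime_period K p > 0"
  using prime_gt_1_nat[of p] power_gt1[of p 1]
  by (auto simp: prime_period_def prime_gt_0_nat numeral_2_eq_2)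

lemma period_bound_pos: "period_bound K m > 0"
  unfolding period_bound_def
  by (intro prod_pos) (auto simp: prime_period_pos prime_gt_0_nat in_prime_factors_iff)

lemma pisano_dvd_period_bound:
  assumes "even K" "K > 0" "m > 0"
  shows "pisano K m > 0" "pisano K m dvd period_bound K m"
proof -
  obtain a where K: "K = 2 * a" using assms by blast
  with assms have a: "a \<ge> 1" by simp
  have "Zsqrt_cong (a\<^sup>2 + 1) m (kunit a ^ period_bound K m) 1"
  proof (rule Zsqrt_cong_if_prime_powers[OF sqrt_Suc_square_irrational[OF a]])
    fix p assume pm: "p \<in> prime_factors m"
    then have p: "prime p" by (simp add: in_prime_factors_iff)
    have "Zsqrt_cong (a\<^sup>2 + 1) p (kunit a ^ prime_period K p) 1"
      using kunit_power_ramified[OF p] kunit_power_unramified[OF p]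
      by (simp add: prime_period_def K)
    from Zsqrt_cong_prime_power[OF p this, of "multiplicity p m - 1"]
    have "Zsqrt_cong (a\<^sup>2 + 1) (p ^ multiplicity p m)
        (kunit a ^ (prime_period K p * p ^ (multiplicity p m - 1))) 1"
      using pm by (simp add: prime_factors_multiplicity del: power_Suc One_nat_def)
    then show "Zsqrt_cong (a\<^sup>2 + 1) (p ^ multiplicity p m) (kunit a ^ period_bound K m) 1"
      by (rule Zsqrt_cong_power_one[OF kunit_Zsqrt])
        (unfold period_bound_def, intro dvd_prodI, use pm in auto)
  qed (intro power_Zsqrt kunit_Zsqrt one_Zsqrt assms(3))+
  then have "[kfib K (n + period_bound K m) = kfib K n] (mod m)" for n
    unfolding K using a by (intro kfib_cong_if_kunit_power)
  from pisano_dvd[OF period_bound_pos this]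
  show "pisano K m > 0" "pisano K m dvd period_bound K m" by auto
qed

text \<open>The primes dividing \<open>4 * p\<close> are 2 and \<open>p\<close>, which divide
  \<open>K\<^sup>2 + 4\<close> whenever \<open>p\<close> does. Otherwise \<open>q\<close> divides
  \<open>p - 1\<close> or \<open>p + 1\<close>, and with \<open>p \<le> q\<close> parity leaves only
  \<open>q = p\<close>, which divides neither.\<close>

lemma not_dvd_prime_period:
  assumes "even K" "prime p" "prime q" "\<not> q dvd K\<^sup>2 + 4" "p dvd K\<^sup>2 + 4 \<or> p \<le> q"
  shows "\<not> q dvd prime_period K p"
proof
  assume q: "q dvd prime_period K p"
  have two: "2 dvd K\<^sup>2 + 4" using assms by simp
  show False
  proof (cases "p dvd K\<^sup>2 + 4")
    case True
    then have "q dvd 2 * 2 * p" using q by (simp add: prime_period_def)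
    then have "q = 2 \<or> q = p"
      using assms(2,3) by (metis prime_dvd_mult_iff primes_dvd_imp_eq two_is_prime_nat)
    then show False using True two assms(4) by blast
  next
    case False
    \<comment> \<open>Neither prime divides \<open>K\<^sup>2 + 4\<close>, whereas 2 does.\<close>
    have "odd p" "odd q"
      using False two assms by (metis primes_dvd_imp_eq two_is_prime_nat)+
    have p1: "p > 1" using assms prime_gt_1_nat by blast
    have "p\<^sup>2 - 1 = (p - 1) * (p + 1)"
      using p1 by (simp add: power2_eq_square algebra_simps)
    then have "q dvd p - 1 \<or> q dvd p + 1"
      using q False assms(3) prime_dvd_mult_iff[of q "p - 1" "p + 1"]
      by (simp only: prime_period_def if_False)
    then have "q \<le> p + 1" "q dvd p - 1 \<longrightarrow> q \<le> p - 1"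
      using p1 by (auto dest: dvd_imp_le)
    moreover have "q \<noteq> p + 1" using \<open>odd p\<close> \<open>odd q\<close> by auto
    ultimately have "q = p" using assms False p1 by linarith
    then show False using \<open>q dvd p - 1 \<or> q dvd p + 1\<close> p1
      by (auto dest: dvd_imp_le simp: dvd_add_right_iff[of p p 1, simplified])
  qed
qed

text \<open>In \<open>period_bound K m\<close> only the power of \<open>q\<close> itself contributes
  to the multiplicity of \<open>q\<close>. If \<open>q\<close> does not divide \<open>m\<close>,
  truncated subtraction makes the bound 0.\<close>

lemma multiplicity_pisano_le:
  assumes K: "even K" "K > 0" and "m > 0" and q: "prime q" "\<not> q dvd K\<^sup>2 + 4"
    and le: "\<And>p. prime p \<Longrightarrow> p dvd m \<Longrightarrow> p dvd K\<^sup>2 + 4 \<or> p \<le> q"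
  shows "multiplicity q (pisano K m) \<le> multiplicity q m - 1"
proof -
  have "multiplicity q (pisano K m) \<le> multiplicity q (period_bound K m)"
    using pisano_dvd_period_bound[OF K \<open>m > 0\<close>] period_bound_pos[of K m]
    by (intro dvd_imp_multiplicity_le) auto
  also have "\<dots> = (\<Sum>p\<in>prime_factors m.
      multiplicity q (prime_period K p * p ^ (multiplicity p m - 1)))"
    unfolding period_bound_def using q prime_period_pos[of _ K]
    by (intro prime_elem_multiplicity_prod_distrib)
      (auto simp: in_prime_factors_iff image_iff)
  also have "\<dots> = (\<Sum>p\<in>prime_factors m. if p = q then multiplicity q m - 1 else 0)"
  proof (rule sum.cong)
    fix p assume "p \<in> prime_factors m"
    then have p: "prime p" "p dvd m" by (auto simp: in_prime_factors_iff)
    have nd: "\<not> q dvd prime_period K p"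
      using K p q le by (intro not_dvd_prime_period) auto
    have "multiplicity q (prime_period K p * p ^ (multiplicity p m - 1))
        = multiplicity q (prime_period K p) + (multiplicity p m - 1) * multiplicity q p"
      using p q prime_period_pos[of p K]
      by (simp add: prime_elem_multiplicity_mult_distrib prime_elem_multiplicity_power_distrib
          prime_gt_0_nat)
    then show "multiplicity q (prime_period K p * p ^ (multiplicity p m - 1))
        = (if p = q then multiplicity q m - 1 else 0)"
      using nd p q by (auto simp: not_dvd_imp_multiplicity_0 prime_multiplicity_other)
  qed simp
  also have "\<dots> \<le> multiplicity q m - 1" by simp
  finally show ?thesis .
qed

text \<open>A new prime \<open>q\<close> above \<open>Q\<close> would bound the relevant primes of
  \<open>m\<close>, so the previous estimate applies to \<open>q\<close> and gives multiplicity
  0.\<close>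

lemma prime_dvd_pisano:
  assumes K: "even K" "K > 0" and "m > 0"
    and le: "\<And>p. prime p \<Longrightarrow> p dvd m \<Longrightarrow> p dvd K\<^sup>2 + 4 \<or> p \<le> Q"
    and q: "prime q" "q dvd pisano K m"
  shows "q dvd K\<^sup>2 + 4 \<or> q \<le> Q"
proof (rule ccontr)
  assume *: "\<not> ?thesis"
  then have "\<not> q dvd m" using le q by blast
  moreover have "p dvd K\<^sup>2 + 4 \<or> p \<le> q" if "prime p" "p dvd m" for p
    using le[OF that] * by linarith
  then have "multiplicity q (pisano K m) \<le> multiplicity q m - 1"
    using * by (intro multiplicity_pisano_le[OF K \<open>m > 0\<close> q(1)]) blast+
  ultimately have "multiplicity q (pisano K m) = 0"
    by (simp add: not_dvd_imp_multiplicity_0)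
  moreover have "multiplicity q (pisano K m) > 0"
    using q pisano_dvd_period_bound(1)[OF K \<open>m > 0\<close>]
    by (simp add: prime_multiplicity_gt_zero_iff)
  ultimately show False by simp
qed

section \<open>Iterating the period map\<close>

text \<open>The outer induction is on the bound \<open>Q\<close> for the primes outside
  \<open>K\<^sup>2 + 4\<close>, the inner one on the multiplicity of the top candidate
  \<open>Suc Q\<close>. Positivity is carried along because each further step requires it.\<close>

lemma pisano_iterate_smooth:
  assumes K: "even K" "K > 0" and "m > 0"
    and "\<And>p. prime p \<Longrightarrow> p dvd m \<Longrightarrow> p dvd K\<^sup>2 + 4 \<or> p \<le> Q"
  shows "\<exists>N. \<forall>n\<ge>N. (pisano K ^^ n) m > 0 \<and>
           (\<forall>p. prime p \<longrightarrow> p dvd (pisano K ^^ n) m \<longrightarrow> p dvd K\<^sup>2 + 4)"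
  using assms(3,4)
proof (induction Q arbitrary: m)
  case 0
  have "(pisano K ^^ n) m > 0 \<and>
      (\<forall>p. prime p \<longrightarrow> p dvd (pisano K ^^ n) m \<longrightarrow> p dvd K\<^sup>2 + 4 \<or> p \<le> 0)" for n
  proof (induction n)
    case (Suc n)
    then show ?case
      using pisano_dvd_period_bound(1)[OF K] prime_dvd_pisano[OF K, of _ 0] by auto
  qed (use 0 in auto)
  then show ?case using prime_gt_0_nat by (metis leD)
next
  case (Suc Q)
  show ?case using Suc.prems
  proof (induction "multiplicity (Suc Q) m" arbitrary: m rule: less_induct)
    case less
    show ?case
    proof (cases "prime (Suc Q) \<and> \<not> Suc Q dvd K\<^sup>2 + 4 \<and> Suc Q dvd m")
      case True
      have "multiplicity (Suc Q) (pisano K m) \<le> multiplicity (Suc Q) m - 1"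
        using True less.prems by (intro multiplicity_pisano_le[OF K]) auto
      moreover have "multiplicity (Suc Q) m > 0"
        using True less.prems by (simp add: prime_multiplicity_gt_zero_iff)
      ultimately have "multiplicity (Suc Q) (pisano K m) < multiplicity (Suc Q) m" by linarith
      from less.hyps[OF this pisano_dvd_period_bound(1)[OF K less.prems(1)]
          prime_dvd_pisano[OF K less.prems]]
      obtain N where "\<forall>n\<ge>N. (pisano K ^^ n) (pisano K m) > 0 \<and>
          (\<forall>p. prime p \<longrightarrow> p dvd (pisano K ^^ n) (pisano K m) \<longrightarrow> p dvd K\<^sup>2 + 4)" by blast
      \<comment> \<open>One application of \<open>pisano K\<close> was spent before the induction
        hypothesis, hence the shift by one.\<close>
      then have "\<forall>n\<ge>Suc N. (pisano K ^^ n) m > 0 \<and>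
          (\<forall>p. prime p \<longrightarrow> p dvd (pisano K ^^ n) m \<longrightarrow> p dvd K\<^sup>2 + 4)"
        by (metis Suc_le_D Suc_le_mono comp_apply funpow_Suc_right)
      then show ?thesis by blast
    next
      \<comment> \<open>The candidate \<open>Suc Q\<close> does not occur, so the bound drops to
        \<open>Q\<close> without iterating.\<close>
      case False
      then have "p dvd K\<^sup>2 + 4 \<or> p \<le> Q" if "prime p" "p dvd m" for p
        using less.prems(2)[OF that] that by (auto simp: le_Suc_eq)
      then show ?thesis using Suc.IH less.prems(1) by blast
    qed
  qed
qed

theorem theorem4p7:
  fixes K m :: nat
  assumes "K \<ge> 1"
    and "[K = 0] (mod 4) \<or> [K = 2] (mod 4)"
    and "m > 1"
  shows "\<exists>N\<ge>1. \<forall>n\<ge>N. \<exists>j :: nat \<Rightarrow> nat.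
           (pisano K ^^ n) m = (\<Prod>p\<in>prime_factors (K\<^sup>2 + 4). p ^ j p)"
proof -
  have "even K" using assms(2) by (auto simp: cong_def) presburger+
  \<comment> \<open>The number \<open>m\<close> itself serves as the initial bound on its
    primes.\<close>
  moreover have "p dvd K\<^sup>2 + 4 \<or> p \<le> m" if "prime p" "p dvd m" for p
    using that assms(3) by (auto dest: dvd_imp_le)
  moreover have "K > 0" "m > 0" using assms by simp_all
  ultimately obtain N where N: "\<forall>n\<ge>N. (pisano K ^^ n) m > 0 \<and>
      (\<forall>p. prime p \<longrightarrow> p dvd (pisano K ^^ n) m \<longrightarrow> p dvd K\<^sup>2 + 4)"
    using pisano_iterate_smooth[of K m m] by meson
  have "(pisano K ^^ n) m =
      (\<Prod>p\<in>prime_factors (K\<^sup>2 + 4). p ^ multiplicity p ((pisano K ^^ n) m))"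
    if "n \<ge> max 1 N" for n
  proof -
    define M where "M = (pisano K ^^ n) m"
    have M: "M > 0" "\<And>p. prime p \<Longrightarrow> p dvd M \<Longrightarrow> p dvd K\<^sup>2 + 4"
      using N that unfolding M_def by (simp, meson max.boundedE)
    have "M = (\<Prod>p\<in>prime_factors M. p ^ multiplicity p M)"
      using M(1) by (rule prime_factorization_nat)
    \<comment> \<open>Primes of \<open>K\<^sup>2 + 4\<close> that do not divide \<open>M\<close>
      enter with exponent 0.\<close>
    also have "\<dots> = (\<Prod>p\<in>prime_factors (K\<^sup>2 + 4). p ^ multiplicity p M)"
      using M
      by (intro prod.mono_neutral_left) (auto simp: in_prime_factors_iff not_dvd_imp_multiplicity_0)
    finally show ?thesis by (simp only: M_def)
  qed
  then have "\<exists>j. (pisano K ^^ n) m = (\<Prod>p\<in>prime_factors (K\<^sup>2 + 4). p ^ j p)"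
    if "n \<ge> max 1 N" for n
    using that by (intro exI[of _ "\<lambda>p. multiplicity p ((pisano K ^^ n) m)"])
  then show ?thesis using max.cobounded1 by blast
qed

end
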